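(* Let $q\ge 1$ and let $\mathbf z=(z_1,z_2,\ldots,z_q)\in\mathbb R^{2q}$, with $z_i=(x_i,y_i)$, be a point that is (uniquely) determined by a total of $2q$ bishops equations and fixations. Then $\mathbf z$ is weakly half integral. Furthermore, for each $i$, either both coordinates of $z_i$ are integers or both coordinates of $z_i$ are strict half integers.
   Context: Coordinates on $\mathbb R^{2q}$ are written $(x_1,y_1,\ldots,x_q,y_q)$, with $z_i=(x_i,y_i)$. A bishops equation is an equation of the form $x_i-y_i=x_j-y_j$ or of the form $x_i+y_i=x_j+y_j$, where $1\le i,j\le q$ and $i\ne j$. A fixation is an equation of the form $x_i=c_i$ with $c_i\in\mathbb Z$, or $y_i=d_i$ with $d_i\in\mathbb Z$. A point is determined by a system of $2q$ such equations ($m$ bishops equations and $2q-m$ fixations, for some $m$) if it is the unique solution in $\mathbb R^{2q}$ of the system. A point is weakly half integral if the least common denominator of its coordinates is $1$ or $2$, i.e., all its coordinates lie in $\frac12\mathbb Z$. A strict half integer is a rational number that, in lowest terms, has denominator $2$. *)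

theory Defs
  imports "HOL-Analysis.Analysis"
begin

text \<open>
  The index type \<open>'q\<close> stands for the set of pieces, so that the number \<open>q \<ge> 1\<close> of pieces is
  \<open>CARD('q)\<close>, and \<open>(real \<times> real) ^ 'q\<close> is the \<open>2q\<close>-dimensional space of all
  \<open>(x\<^sub>1, y\<^sub>1, \<dots>, x\<^sub>q, y\<^sub>q)\<close>, with \<open>z $ i = (x\<^sub>i, y\<^sub>i)\<close>.
\<close>

type_synonym 'q configuration = "(real \<times> real) ^ 'q"

abbreviation xcoord :: "'q::finite configuration \<Rightarrow> 'q \<Rightarrow> real" where
  "xcoord z i \<equiv> fst (z $ i)"

abbreviation ycoord :: "'q::finite configuration \<Rightarrow> 'q \<Rightarrow> real" where
  "ycoord z i \<equiv> snd (z $ i)"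

text \<open>
  Equations are kept as syntactic objects so that they can be counted. The condition \<open>i \<noteq> j\<close> on
  bishops equations is imposed separately below. An equation and the one with \<open>i\<close> and \<open>j\<close>
  exchanged are different objects with the same solutions; a system of \<open>2q\<close> equations containing
  both cannot have a unique solution.
\<close>

datatype 'q equation =
    Diff_Eq 'q 'q
  | Sum_Eq 'q 'q
  | Fix_X 'q int
  | Fix_Y 'q int

fun satisfies :: "'q::finite configuration \<Rightarrow> 'q equation \<Rightarrow> bool" where
  "satisfies z (Diff_Eq i j) \<longleftrightarrow> xcoord z i - ycoord z i = xcoord z j - ycoord z j"
| "satisfies z (Sum_Eq i j) \<longleftrightarrow> xcoord z i + ycoord z i = xcoord z j + ycoord z j"
| "satisfies z (Fix_X i c) \<longleftrightarrow> xcoord z i = of_int c"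
| "satisfies z (Fix_Y i d) \<longleftrightarrow> ycoord z i = of_int d"

definition bishops_equations :: "'q equation set" where
  "bishops_equations = {Diff_Eq i j | i j. i \<noteq> j} \<union> {Sum_Eq i j | i j. i \<noteq> j}"

definition fixations :: "'q equation set" where
  "fixations = {Fix_X i c | i c. True} \<union> {Fix_Y i d | i d. True}"

definition determined_by :: "'q::finite configuration \<Rightarrow> 'q equation set \<Rightarrow> bool" where
  "determined_by z S \<longleftrightarrow> {w. \<forall>e\<in>S. satisfies w e} = {z}"

definition common_denominator :: "nat \<Rightarrow> 'q::finite configuration \<Rightarrow> bool" where
  "common_denominator d z \<longleftrightarrow>
     d > 0 \<and> (\<forall>i. real d * xcoord z i \<in> \<int> \<and> real d * ycoord z i \<in> \<int>)"

text \<open>A relation rather than a function, as a point with an irrational coordinate has none.\<close>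

definition least_common_denominator :: "nat \<Rightarrow> 'q::finite configuration \<Rightarrow> bool" where
  "least_common_denominator d z \<longleftrightarrow>
     common_denominator d z \<and> (\<forall>d'. common_denominator d' z \<longrightarrow> d \<le> d')"

definition weakly_half_integral :: "'q::finite configuration \<Rightarrow> bool" where
  "weakly_half_integral z \<longleftrightarrow>
     least_common_denominator 1 z \<or> least_common_denominator 2 z"

lemma weakly_half_integral_iff:
  "weakly_half_integral z \<longleftrightarrow> (\<forall>i. 2 * xcoord z i \<in> \<int> \<and> 2 * ycoord z i \<in> \<int>)"
proof
  assume "weakly_half_integral z"
  then show "\<forall>i. 2 * xcoord z i \<in> \<int> \<and> 2 * ycoord z i \<in> \<int>"
    by (auto simp: weakly_half_integral_def least_common_denominator_def common_denominator_def)
next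
  assume 2: "\<forall>i. 2 * xcoord z i \<in> \<int> \<and> 2 * ycoord z i \<in> \<int>"
  show "weakly_half_integral z"
  proof (cases "common_denominator 1 z")
    case True
    then show ?thesis
      by (auto simp: weakly_half_integral_def least_common_denominator_def common_denominator_def)
  next
    case False
    have "2 \<le> d'" if "common_denominator d' z" for d'
    proof -
      have "d' \<noteq> 0" "d' \<noteq> 1"
        using that False unfolding common_denominator_def by auto
      then show ?thesis by simp
    qed
    with 2 show ?thesis
      by (auto simp: weakly_half_integral_def least_common_denominator_def common_denominator_def)
  qed
qed

text \<open>\<open>quotient_of r\<close> is the pair of numerator and positive denominator of \<open>r\<close> in lowest terms.\<close>

definition strict_half_integer :: "real \<Rightarrow> bool" where
  "strict_half_integer x \<longleftrightarrow> (\<exists>r::rat. x = of_rat r \<and> snd (quotient_of r) = 2)"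

end

theory Submission
  imports Defs
begin

text \<open>
  Put \<open>s\<^sub>i = x\<^sub>i + y\<^sub>i\<close> and \<open>d\<^sub>i = x\<^sub>i - y\<^sub>i\<close>. Bishops equations equate two of the \<open>s\<^sub>i\<close> or two of the
  \<open>d\<^sub>i\<close>, while fixations say that \<open>s\<^sub>i + d\<^sub>i\<close> or \<open>s\<^sub>i - d\<^sub>i\<close> is an even integer. As the function
  \<open>f t = sin (\<pi> t)\<close> is odd with period \<open>2\<close>, replacing every \<open>s\<^sub>i\<close> by \<open>s\<^sub>i + f s\<^sub>i\<close> and every \<open>d\<^sub>i\<close> by
  \<open>d\<^sub>i + f d\<^sub>i\<close> maps solutions to solutions. A unique solution is therefore fixed by this map,
  that is, all \<open>s\<^sub>i\<close> and \<open>d\<^sub>i\<close> are zeros of \<open>f\<close> and hence integers. The two coordinates of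
  \<open>z\<^sub>i\<close> are \<open>(s\<^sub>i \<plusminus> d\<^sub>i) / 2\<close>, with numerators of the same parity.
\<close>

text \<open>Halving \<open>p + m\<close> and \<open>p - m\<close> turns the shifts \<open>p\<close>
  of the sum and \<open>m\<close> of the difference into shifts of the coordinates.\<close>

definition sine_shift :: "'q::finite configuration \<Rightarrow> 'q configuration" where
  "sine_shift z = (\<chi> i.
     let p = sin (pi * (xcoord z i + ycoord z i)); m = sin (pi * (xcoord z i - ycoord z i))
     in (xcoord z i + (p + m) / 2, ycoord z i + (p - m) / 2))"

lemma sum_sine_shift:
  "xcoord (sine_shift z) i + ycoord (sine_shift z) i =
     xcoord z i + ycoord z i + sin (pi * (xcoord z i + ycoord z i))"
  by (simp add: sine_shift_def Let_def field_simps)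

lemma diff_sine_shift:
  "xcoord (sine_shift z) i - ycoord (sine_shift z) i =
     xcoord z i - ycoord z i + sin (pi * (xcoord z i - ycoord z i))"
  by (simp add: sine_shift_def Let_def field_simps)

text \<open>The sign \<open>cos (pi * of_int c)\<close> can stay unevaluated: at a fixation it is a
  factor of both \<open>p\<close> and \<open>m\<close>, and the shift of the fixed coordinate
  cancels.\<close>

lemma sin_pi_int_plus: "sin (pi * (of_int c + t)) = cos (pi * of_int c) * sin (pi * t)"
  by (simp add: distrib_left sin_add sin_zero_iff_int2 mult.commute[of pi "of_int c"])

lemma sin_pi_int_minus: "sin (pi * (of_int c - t)) = - cos (pi * of_int c) * sin (pi * t)"
  using sin_pi_int_plus[of c "- t"] by simp

lemma sin_pi_minus_int: "sin (pi * (t - of_int c)) = cos (pi * of_int c) * sin (pi * t)"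
  using sin_pi_int_minus[of c t] sin_minus[of "pi * (of_int c - t)"]
  by (simp add: algebra_simps)

lemma satisfies_sine_shift:
  assumes "satisfies z e"
  shows "satisfies (sine_shift z) e"
proof (cases e)
  case (Diff_Eq i j)
  with assms show ?thesis by (simp add: diff_sine_shift)
next
  case (Sum_Eq i j)
  with assms show ?thesis by (simp add: sum_sine_shift)
next
  case (Fix_X i c)
  with assms show ?thesis
    by (simp add: sine_shift_def Let_def sin_pi_int_plus sin_pi_int_minus)
next
  case (Fix_Y i d)
  with assms show ?thesis
    by (simp add: sine_shift_def Let_def sin_pi_int_plus sin_pi_minus_int
        add.commute[of _ "of_int d"])
qed

lemma determined_by_sum_diff_Ints:
  assumes "determined_by z S"
  shows "xcoord z i + ycoord z i \<in> \<int>" "xcoord z i - ycoord z i \<in> \<int>"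
proof -
  have "sine_shift z = z"
    using assms satisfies_sine_shift[of z] unfolding determined_by_def by blast
  then have "sin (pi * (xcoord z i + ycoord z i)) = 0" "sin (pi * (xcoord z i - ycoord z i)) = 0"
    using sum_sine_shift[of z i] diff_sine_shift[of z i] by auto
  then show "xcoord z i + ycoord z i \<in> \<int>" "xcoord z i - ycoord z i \<in> \<int>"
    by (auto simp: sin_zero_iff_int2 mult.commute[of _ pi])
qed

lemma strict_half_integer_odd_half:
  assumes "odd k"
  shows "strict_half_integer (of_int k / 2)"
proof -
  have "coprime k 2"
    using assms by (simp add: coprime_commute)
  then have "quotient_of (Fract k 2) = (k, 2)"
    by (simp add: quotient_of_Fract Rat.normalize_def coprime_iff_gcd_eq_1)
  then show ?thesis
    unfolding strict_half_integer_def by (intro exI[of _ "Fract k 2"]) (simp add: of_rat_rat)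
qed

lemma half_sum_diff_cases:
  fixes x y :: real
  assumes "x + y \<in> \<int>" "x - y \<in> \<int>"
  shows "(x \<in> \<int> \<and> y \<in> \<int>) \<or> (strict_half_integer x \<and> strict_half_integer y)"
proof -
  obtain a b where "x + y = of_int a" "x - y = of_int b"
    using assms by (auto elim!: Ints_cases)
  then have xy: "x = of_int (a + b) / 2" "y = of_int (a - b) / 2"
    by simp_all
  \<comment> \<open>The numerators differ by \<open>2 * b\<close>, so the parity of one decides both
    coordinates.\<close>
  show ?thesis
  proof (cases "even (a + b)")
    case True
    then have "even (a - b)" by simp
    with True obtain k l where "a + b = 2 * k" "a - b = 2 * l"
      by (elim evenE)
    with xy show ?thesis by (simp del: of_int_add of_int_diff)
  next
    case False
    then have "odd (a - b)" by simp
    with False xy show ?thesis by (simp only: strict_half_integer_odd_half simp_thms)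
  qed
qed

theorem lemma4p4:
  fixes z :: "'q::finite configuration" and S :: "'q equation set"
  assumes "S \<subseteq> bishops_equations \<union> fixations"
    and "finite S" and "card S = 2 * CARD('q)"
    and "determined_by z S"
  shows "weakly_half_integral z \<and>
    (\<forall>i. (xcoord z i \<in> \<int> \<and> ycoord z i \<in> \<int>) \<or>
         (strict_half_integer (xcoord z i) \<and> strict_half_integer (ycoord z i)))"
proof -
  note ints = determined_by_sum_diff_Ints[OF assms(4)]
  \<comment> \<open>Doubled coordinates are the sum and the difference of the integers in
    \<open>ints\<close>.\<close>
  have "2 * xcoord z i \<in> \<int>" "2 * ycoord z i \<in> \<int>" for i
    using Ints_add[OF ints[of i]] Ints_diff[OF ints[of i]] by simp_all
  then show ?thesis
    unfolding weakly_half_integral_iff using half_sum_diff_cases[OF ints] by blast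
qed

end
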